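(* Let $A$ be a finite alphabet, let $C\subseteq A^\ast$ be an infinite, finitely based downward closed set under the factor ordering, and let $b$ be the maximum length of a basis element of $C$. Then $C$ is atomic if and only if the following two conditions are satisfied: (i) the factor graph $\Gamma(C)$ is strongly connected or is a bicycle; and (ii) for each word $u\in C$ with $|u|<b$ there is a word $v\in C$ with $|v|=b$ which contains $u$ as a factor.
   Context: A word $u\in A^\ast$ is a factor of $v\in A^\ast$ ($u\le_f v$) if $v=yuz$ for some $y,z\in A^\ast$. $C\subseteq A^\ast$ is downward closed if $v\in C$, $u\le_f v$ imply $u\in C$. The basis of $C$ is the set of $\le_f$-minimal elements of $A^\ast\setminus C$; $C$ is finitely based if its basis is finite. The basis is understood to be nonempty, so that $b$ is defined. $C$ is atomic if it is not the union of two proper downward closed subsets (equivalently, for all $x,y\in C$ there is $z\in C$ with $x\le_f z$, $y\le_f z$). The factor graph $\Gamma(C)$ is the digraph whose vertices are the words of length $b$ in $C$, with an edge from $w$ to $w'$ precisely when $w=au$ and $w'=ua'$ for some $a,a'\in A$ and a word $u$ of length $b-1$ (an induced subgraph of the $b$-dimensional de Bruijn graph over $A$; loops are allowed). In a digraph, a path is a sequence $v_1\to\dots\to v_k$ ($k\ge1$) with an edge from $v_i$ to $v_{i+1}$ for each $i$; it is simple if its vertices are distinct; a simple cycle is a path with $k\ge2$, $v_1=v_k$ and $v_1,\dots,v_{k-1}$ distinct. A digraph is strongly connected if for any two vertices $u,v$ there are paths from $u$ to $v$ and from $v$ to $u$. A bicycle is a digraph consisting precisely of two vertex-disjoint simple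 cycles $\pi_1$ (initial cycle) and $\pi_2$ (terminal cycle), connected by a simple directed path $\tau$ (connecting path) from a vertex of $\pi_1$ to a vertex of $\pi_2$, no internal vertex of which belongs to $\pi_1$ or $\pi_2$. Either or both of $\pi_1,\pi_2$ are allowed to be absent (so a simple path, or a simple cycle with a simple path leading into it or out of it and otherwise disjoint from it, are bicycles), and a single simple cycle is also a bicycle; but if both cycles are present they share no vertex. *)

theory Defs
  imports "HOL-Library.Sublist" "Graph_Theory.Graph_Theory"
begin

text \<open>Words over the alphabet \<open>A\<close> are the elements of \<^term>\<open>lists A\<close>; the factor ordering
  is \<^const>\<open>sublist\<close> (contiguous sublists).\<close>

definition downward_closed :: "'a set \<Rightarrow> 'a list set \<Rightarrow> bool" where
  "downward_closed A C \<longleftrightarrow>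
     C \<subseteq> lists A \<and> (\<forall>v\<in>C. \<forall>u\<in>lists A. sublist u v \<longrightarrow> u \<in> C)"

definition factor_basis :: "'a set \<Rightarrow> 'a list set \<Rightarrow> 'a list set" where
  "factor_basis A C =
     {w \<in> lists A - C. \<forall>u \<in> lists A - C. sublist u w \<longrightarrow> u = w}"

text \<open>Meaningful only when the basis is finite and nonempty.\<close>

definition max_basis_length :: "'a set \<Rightarrow> 'a list set \<Rightarrow> nat" where
  "max_basis_length A C = Max (length ` factor_basis A C)"

definition atomic_set :: "'a set \<Rightarrow> 'a list set \<Rightarrow> bool" where
  "atomic_set A C \<longleftrightarrow>
     \<not> (\<exists>D E. downward_closed A D \<and> downward_closed A E \<and> D \<subset> C \<and> E \<subset> C \<and> C = D \<union> E)"

definition factor_graph :: "'a set \<Rightarrow> 'a list set \<Rightarrow> 'a list pair_pre_digraph" where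
  "factor_graph A C =
     (let b = max_basis_length A C; V = {w \<in> C. length w = b} in
      \<lparr> pverts = V,
        parcs = {(w, w'). w \<in> V \<and> w' \<in> V \<and>
          (\<exists>a\<in>A. \<exists>a'\<in>A. \<exists>u\<in>lists A. length u = b - 1 \<and> w = a # u \<and> w' = u @ [a'])} \<rparr>)"

text \<open>Paths are nonempty vertex lists (\<^const>\<open>vwalk\<close>), simple paths are \<^const>\<open>vpath\<close>. A cycle
  repeats its first vertex at the end, so a loop at \<open>v\<close> is the simple cycle \<open>[v, v]\<close>.\<close>

definition simple_cycle :: "'v list \<Rightarrow> 'v pair_pre_digraph \<Rightarrow> bool" where
  "simple_cycle p G \<longleftrightarrow>
     vwalk p (with_proj G) \<and> length p \<ge> 2 \<and> hd p = last p \<and> distinct (butlast p)"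

text \<open>The initial cycle \<open>p\<close>, the connecting path \<open>t\<close> and the terminal cycle \<open>q\<close> together make up
  the whole digraph. The empty list encodes an absent cycle. If \<open>p\<close> is present, \<open>t\<close> meets it
  exactly in its first vertex; if \<open>q\<close> is present, \<open>t\<close> meets it exactly in its last vertex.
  A lone cycle arises by taking \<open>t\<close> to consist of one vertex of \<open>p\<close>, with \<open>q\<close> absent.\<close>

definition bicycle :: "'v pair_pre_digraph \<Rightarrow> bool" where
  "bicycle G \<longleftrightarrow> (\<exists>p t q.
     (p = [] \<or> simple_cycle p G) \<and> (q = [] \<or> simple_cycle q G) \<and> vpath t (with_proj G) \<and>
     set p \<inter> set q = {} \<and>
     (p \<noteq> [] \<longrightarrow> hd t \<in> set p) \<and> set (tl t) \<inter> set p = {} \<and>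
     (q \<noteq> [] \<longrightarrow> last t \<in> set q) \<and> set (butlast t) \<inter> set q = {} \<and>
     pverts G = set p \<union> set t \<union> set q \<and>
     parcs G = set (vwalk_arcs p) \<union> set (vwalk_arcs t) \<union> set (vwalk_arcs q))"

end

theory Submission
  imports Defs
begin

text \<open>The theorem is a statement about joint embedding, made twice. A downward closed set of words is
  atomic iff any two of its words are factors of a third one (\<open>atomic_set_iff_directed\<close>). Sliding a
  window of length \<open>b\<close> along a word turns the words of \<open>C\<close> of length at least \<open>b\<close> into exactly the
  walks of the factor graph: no basis element is longer than \<open>b\<close>, so a word with all its windows in
  \<open>C\<close> contains no basis element. This correspondence preserves and reflects the factor ordering.
  Since \<open>C\<close> is infinite it has long words, and jointly embedding a short word with a long one is
  what condition (ii) records. Hence \<open>C\<close> is atomic iff (ii) holds and any two walks of the factor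
  graph are factors of a common walk (\<open>directed_iff\<close>).

  It remains to see that, for a finite nonempty digraph, any two walks lie on a common walk iff the
  digraph is strongly connected or is a bicycle (\<open>joint_walks_iff\<close>). In a strongly connected digraph
  one goes from the end of one walk to the start of the other. Otherwise joint embedding provides
  an arc \<open>(x, y)\<close> such that \<open>y\<close> cannot reach \<open>x\<close>. A walk uses such an arc at most once, so two walks
  through it can only be embedded together by placing their two copies of the arc on top of each
  other; the parts before it, and the parts after it, must then agree as far as both extend. This rigidity
  forces every vertex that reaches \<open>x\<close> to have at most one predecessor, every vertex reachable
  from \<open>y\<close> to have at most one successor, and \<open>(x, y)\<close> to be the only arc between these two
  sets, which together exhaust the digraph. Such a digraph is called hinged below. Following the unique
  successors from \<open>y\<close>, and the unique predecessors from \<open>x\<close>, one obtains a simple path that stops or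
  closes up into a cycle; the two pieces joined by \<open>(x, y)\<close> form a bicycle. Conversely, every bicycle
  whose connecting path has an arc is hinged, the remaining ones are a single vertex or a
  single cycle and so strongly connected; and in a hinged digraph every walk extends to one through
  \<open>(x, y)\<close>, where determinism on both sides makes any two such walks compatible.\<close>

section \<open>Walks and reachability\<close>

lemma walk_of_rtrancl:
  assumes "(u, v) \<in> E\<^sup>*"
  obtains p where "p \<noteq> []" "hd p = u" "last p = v" "set (vwalk_arcs p) \<subseteq> E"
proof -
  have "\<exists>p. p \<noteq> [] \<and> hd p = u \<and> last p = v \<and> set (vwalk_arcs p) \<subseteq> E"
    using assms
  proof (induction rule: converse_rtrancl_induct)
    case base
    show ?case by (intro exI[of _ "[v]"]) simp
  next
    case (step y z)
    then obtain p where "p \<noteq> []" "hd p = z" "last p = v" "set (vwalk_arcs p) \<subseteq> E" by blast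
    with step show ?case by (intro exI[of _ "y # p"]) simp
  qed
  with that show thesis by blast
qed

lemma hd_reaches:
  assumes "set (vwalk_arcs p) \<subseteq> E" "w \<in> set p"
  shows "(hd p, w) \<in> E\<^sup>*"
  using assms
  by (induction p rule: vwalk_arcs.induct) (auto intro: converse_rtrancl_into_rtrancl)

lemma reaches_last:
  assumes "set (vwalk_arcs p) \<subseteq> E" "w \<in> set p"
  shows "(w, last p) \<in> E\<^sup>*"
  using assms
proof (induction p arbitrary: w rule: vwalk_arcs.induct)
  case (3 x y xs)
  have IH: "(v, last (y # xs)) \<in> E\<^sup>*" if "v \<in> set (y # xs)" for v
    using 3 that by simp
  show ?case
  proof (cases "w \<in> set (y # xs)")
    case True
    then show ?thesis using IH by simp
  next
    case False
    then have "w = x" "(x, y) \<in> E" using 3 by auto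
    with IH[of y] show ?thesis by (auto intro: converse_rtrancl_into_rtrancl)
  qed
qed auto

lemma set_walk_subset:
  assumes "E \<subseteq> V \<times> V" "set (vwalk_arcs p) \<subseteq> E" "hd p \<in> V"
  shows "set p \<subseteq> V"
  using assms by (induction p rule: vwalk_arcs.induct) auto

lemma set_walk_subset_last:
  assumes "E \<subseteq> V \<times> V" "set (vwalk_arcs p) \<subseteq> E" "last p \<in> V"
  shows "set p \<subseteq> V"
  using assms by (induction p rule: vwalk_arcs.induct) auto

lemma walk_sublist:
  assumes "set (vwalk_arcs r) \<subseteq> E" "sublist p r"
  shows "set (vwalk_arcs p) \<subseteq> E"
proof -
  from assms(2) obtain a b where "r = a @ p @ b" by (auto simp: sublist_def)
  then have "set (vwalk_arcs p) \<subseteq> set (vwalk_arcs r)"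
    using set_vwalk_arcs_append1[of p b] set_vwalk_arcs_append2[of "p @ b" a] by auto
  with assms(1) show ?thesis by blast
qed

lemma walk_join:
  assumes "set (vwalk_arcs p) \<subseteq> E" "set (vwalk_arcs q) \<subseteq> E"
    and "p \<noteq> []" "q \<noteq> []" "last p = hd q"
  shows "set (vwalk_arcs (p @ tl q)) \<subseteq> E" "last (p @ tl q) = last q" "suffix q (p @ tl q)"
proof -
  obtain q' where q: "q = hd q # q'" using assms(4) by (cases q) auto
  show "last (p @ tl q) = last q" using assms(5) q by (metis last_appendR last_ConsL last_ConsR
      append_Nil2 list.sel(3))
  have "p @ tl q = butlast p @ q"
    using assms(3,5) q by (metis append.assoc append_Cons append_Nil append_butlast_last_id list.sel(3))
  then show "suffix q (p @ tl q)" by (simp add: suffix_def)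
  show "set (vwalk_arcs (p @ tl q)) \<subseteq> E"
  proof (cases "tl q = []")
    case False
    then obtain v q'' where "q = hd q # v # q''" using q by (metis list.exhaust list.sel(3))
    then show ?thesis using assms by (metis False list.sel(1,3) vwalk_arcs.simps(3)
          vwalk_arcs_append set_append Un_subset_iff)
  qed (use assms in simp)
qed

lemma strongly_connected_with_proj_iff:
  assumes "parcs G \<subseteq> pverts G \<times> pverts G"
  shows "strongly_connected (with_proj G) \<longleftrightarrow>
    pverts G \<noteq> {} \<and> (\<forall>u\<in>pverts G. \<forall>v\<in>pverts G. (u, v) \<in> (parcs G)\<^sup>*)"
proof -
  have "u \<rightarrow>\<^sup>*\<^bsub>with_proj G\<^esub> v \<longleftrightarrow> (u, v) \<in> (parcs G)\<^sup>*" if "u \<in> pverts G" "v \<in> pverts G" for u v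
    using that assms rtrancl_consistent_rtrancl_on[of u v "parcs G" "pverts G"]
      rtrancl_on_rtranclI[of u v "pverts G" "parcs G"]
    by (auto simp: reachable_def)
  then show ?thesis by (auto simp: strongly_connected_def)
qed

section \<open>Joint embedding of walks\<close>

definition joint_walks :: "'v pair_pre_digraph \<Rightarrow> bool" where
  "joint_walks G \<longleftrightarrow> (\<forall>p q. vwalk p (with_proj G) \<longrightarrow> vwalk q (with_proj G) \<longrightarrow>
     (\<exists>r. vwalk r (with_proj G) \<and> sublist p r \<and> sublist q r))"

text \<open>The digraph traced out by a deterministic process started at \<open>y\<close>: what becomes of a bicycle on
  either side of an arc of its connecting path (on the initial side after reversing all arcs).\<close>

definition thread :: "('v \<times> 'v) set \<Rightarrow> 'v set \<Rightarrow> 'v \<Rightarrow> bool" where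
  "thread E S y \<longleftrightarrow> y \<in> S \<and> E \<subseteq> S \<times> S \<and> (\<forall>v\<in>S. (y, v) \<in> E\<^sup>*) \<and> single_valued E"

definition hinged :: "'v pair_pre_digraph \<Rightarrow> bool" where
  "hinged G \<longleftrightarrow> (\<exists>B EB x y EF F.
     pverts G = B \<union> F \<and> B \<inter> F = {} \<and> parcs G = EB \<union> {(x, y)} \<union> EF \<and>
     thread (EB\<inverse>) B x \<and> thread EF F y)"

section \<open>Strongly connected and hinged digraphs have joint embedding\<close>

lemma single_valued_walks_comparable:
  assumes "single_valued E" "set (vwalk_arcs p) \<subseteq> E" "set (vwalk_arcs q) \<subseteq> E"
    and "p \<noteq> []" "q \<noteq> []" "hd p = hd q"
  shows "prefix p q \<or> prefix q p"
  using assms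
proof (induction p arbitrary: q rule: vwalk_arcs.induct)
  case (2 x)
  then show ?case by (cases q) auto
next
  case (3 x y xs)
  show ?case
  proof (cases "tl q = []")
    case True
    with "3.prems" show ?thesis by (cases q) auto
  next
    case False
    with "3.prems" obtain z zs where q: "q = x # z # zs" by (cases q; cases "tl q") auto
    with "3.prems" have "z = y" by (auto dest: single_valuedD)
    with q "3.IH"[of "z # zs"] "3.prems" show ?thesis by auto
  qed
qed auto

lemma strongly_connected_imp_joint_walks:
  assumes wf: "parcs G \<subseteq> pverts G \<times> pverts G" and "strongly_connected (with_proj G)"
  shows "joint_walks G"
  unfolding joint_walks_def
proof (intro allI impI)
  fix p q
  assume p: "vwalk p (with_proj G)" and q: "vwalk q (with_proj G)"
  have "last p \<in> pverts G" "hd q \<in> pverts G" using p q by (auto simp: vwalk_def)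
  then have "(last p, hd q) \<in> (parcs G)\<^sup>*"
    using assms by (simp add: strongly_connected_with_proj_iff)
  then obtain s where s: "s \<noteq> []" "hd s = last p" "last s = hd q" "set (vwalk_arcs s) \<subseteq> parcs G"
    by (rule walk_of_rtrancl)
  have ps: "set (vwalk_arcs (p @ tl s)) \<subseteq> parcs G" "last (p @ tl s) = hd q"
    using walk_join[of p "parcs G" s] p s by (auto simp: vwalk_def)
  let ?r = "(p @ tl s) @ tl q"
  have r: "set (vwalk_arcs ?r) \<subseteq> parcs G" "suffix q ?r"
    using walk_join[of "p @ tl s" "parcs G" q] ps p q by (auto simp: vwalk_def)
  have "set ?r \<subseteq> pverts G"
    using p by (intro set_walk_subset[OF wf r(1)]) (auto simp: vwalk_def)
  with r p have "vwalk ?r (with_proj G)" by (intro vwalkI) (auto simp: vwalk_def)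
  moreover have "sublist p ?r" by simp
  moreover have "sublist q ?r" using r(2) by (rule suffix_imp_sublist)
  ultimately show "\<exists>r. vwalk r (with_proj G) \<and> sublist p r \<and> sublist q r" by blast
qed

text \<open>No arc leads from \<open>F\<close> back to \<open>B\<close>, so a walk consists of a part in \<open>B\<close> followed by a part in \<open>F\<close>;
  it can pass from one to the other only through the hinge \<open>(x, y)\<close>.\<close>

lemma hinge_split:
  assumes "thread (EB\<inverse>) B x" "thread EF F y" "B \<inter> F = {}"
    and "set (vwalk_arcs w) \<subseteq> EB \<union> {(x, y)} \<union> EF" "set w \<subseteq> B \<union> F"
  obtains w1 w2 where "w = w1 @ w2" "set w1 \<subseteq> B" "set (vwalk_arcs w1) \<subseteq> EB"
    "set w2 \<subseteq> F" "set (vwalk_arcs w2) \<subseteq> EF" "w1 \<noteq> [] \<Longrightarrow> w2 \<noteq> [] \<Longrightarrow> last w1 = x \<and> hd w2 = y"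
proof -
  have "\<exists>w1 w2. w = w1 @ w2 \<and> set w1 \<subseteq> B \<and> set (vwalk_arcs w1) \<subseteq> EB \<and>
    set w2 \<subseteq> F \<and> set (vwalk_arcs w2) \<subseteq> EF \<and> (w1 \<noteq> [] \<longrightarrow> w2 \<noteq> [] \<longrightarrow> last w1 = x \<and> hd w2 = y)"
    using assms(4,5)
  proof (induction w)
    case (Cons v w)
    then obtain w1 w2 where w: "w = w1 @ w2" "set w1 \<subseteq> B" "set (vwalk_arcs w1) \<subseteq> EB"
      "set w2 \<subseteq> F" "set (vwalk_arcs w2) \<subseteq> EF" "w1 \<noteq> [] \<longrightarrow> w2 \<noteq> [] \<longrightarrow> last w1 = x \<and> hd w2 = y"
      using set_vwalk_arcs_cons[of w v] by auto
    have sub: "EB \<subseteq> B \<times> B" "EF \<subseteq> F \<times> F" "x \<in> B" "y \<in> F"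
      using assms(1,2) by (auto simp: thread_def)
    show ?case
    proof (cases "w1 = []")
      case False
      then have "(v, hd w1) \<in> EB \<union> {(x, y)} \<union> EF" using Cons.prems w by auto
      moreover have "hd w1 \<in> B" using False w(2) by auto
      ultimately have "(v, hd w1) \<in> EB" using sub assms(3) by auto
      with w False sub show ?thesis by (intro exI[of _ "v # w1"] exI[of _ w2]) auto
    next
      case w1: True
      show ?thesis
      proof (cases "w2 = [] \<or> v \<in> B")
        case True
        show ?thesis
        proof (cases "v \<in> B")
          case True
          have "w2 \<noteq> [] \<longrightarrow> v = x \<and> hd w2 = y"
          proof
            assume "w2 \<noteq> []"
            then have "(v, hd w2) \<in> EB \<union> {(x, y)} \<union> EF" "hd w2 \<in> F" using Cons.prems w w1 by auto
            with True sub assms(3) show "v = x \<and> hd w2 = y" by auto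
          qed
          with True w w1 show ?thesis by (intro exI[of _ "[v]"] exI[of _ w2]) auto
        next
          case False
          with True Cons.prems w w1 show ?thesis
            by (intro exI[of _ "[]"] exI[of _ "[v]"]) auto
        qed
      next
        case False
        then have "(v, hd w2) \<in> EB \<union> {(x, y)} \<union> EF" "v \<in> F" "w2 \<noteq> []"
          using Cons.prems w w1 by auto
        then have "(v, hd w2) \<in> EF" using sub assms(3) by auto
        with w w1 \<open>v \<in> F\<close> \<open>w2 \<noteq> []\<close> show ?thesis by (intro exI[of _ "[]"] exI[of _ "v # w2"]) auto
      qed
    qed
  qed auto
  with that show thesis by blast
qed

text \<open>A walk that stays in \<open>B\<close> can be continued to \<open>x\<close>, and one that stays in \<open>F\<close> can be preceded by
  a walk from \<open>y\<close>; so every walk extends to one that traverses the hinge.\<close>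

lemma hinge_extend:
  assumes B: "thread (EB\<inverse>) B x" and F: "thread EF F y" and disj: "B \<inter> F = {}"
    and w: "set (vwalk_arcs w) \<subseteq> EB \<union> {(x, y)} \<union> EF" "set w \<subseteq> B \<union> F" "w \<noteq> []"
  obtains p q where "p \<noteq> []" "q \<noteq> []" "last p = x" "hd q = y"
    "set (vwalk_arcs p) \<subseteq> EB" "set (vwalk_arcs q) \<subseteq> EF" "sublist w (p @ q)"
proof -
  obtain w1 w2 where s: "w = w1 @ w2" "set w1 \<subseteq> B" "set (vwalk_arcs w1) \<subseteq> EB"
    "set w2 \<subseteq> F" "set (vwalk_arcs w2) \<subseteq> EF" "w1 \<noteq> [] \<Longrightarrow> w2 \<noteq> [] \<Longrightarrow> last w1 = x \<and> hd w2 = y"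
    using hinge_split[OF B F disj w(1,2)] by blast
  consider "w1 \<noteq> []" "w2 \<noteq> []" | "w1 \<noteq> []" "w2 = []" | "w1 = []" "w2 \<noteq> []"
    using s w by blast
  then show thesis
  proof cases
    case 1
    with s show thesis by (intro that[of w1 w2]) auto
  next
    case 2
    then have "last w1 \<in> B" using s(2) by auto
    then have "(x, last w1) \<in> (EB\<inverse>)\<^sup>*" using B by (simp add: thread_def)
    then have "(last w1, x) \<in> EB\<^sup>*" by (simp add: rtrancl_converse)
    then obtain u where u: "u \<noteq> []" "hd u = last w1" "last u = x" "set (vwalk_arcs u) \<subseteq> EB"
      by (rule walk_of_rtrancl)
    show thesis
    proof (rule that)
      show "set (vwalk_arcs (w1 @ tl u)) \<subseteq> EB" "last (w1 @ tl u) = x"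
        using walk_join[of w1 EB u] 2 s u by simp_all
      show "sublist w ((w1 @ tl u) @ [y])" using s(1) 2 by simp
    qed (use 2 in auto)
  next
    case 3
    then have "hd w2 \<in> F" using s(4) by auto
    then have "(y, hd w2) \<in> EF\<^sup>*" using F by (simp add: thread_def)
    then obtain u where u: "u \<noteq> []" "hd u = y" "last u = hd w2" "set (vwalk_arcs u) \<subseteq> EF"
      by (rule walk_of_rtrancl)
    have g: "set (vwalk_arcs (u @ tl w2)) \<subseteq> EF" "suffix w2 (u @ tl w2)"
      using walk_join[of u EF w2] 3 s u by simp_all
    show thesis
    proof (rule that)
      show "hd (u @ tl w2) = y" using u by simp
      show "sublist w ([x] @ (u @ tl w2))"
        using g(2) s(1) 3 by (auto intro: suffix_ConsI simp: sublist_Cons_right)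
    qed (use g u in auto)
  qed
qed

text \<open>Two walks through the hinge have comparable parts on either side of it, because backwards from \<open>x\<close>
  and forwards from \<open>y\<close> there is never a choice. The longer part on each side gives the common walk.\<close>

lemma hinged_imp_joint_walks:
  assumes "hinged G"
  shows "joint_walks G"
  unfolding joint_walks_def
proof (intro allI impI)
  fix v w
  assume v: "vwalk v (with_proj G)" and w: "vwalk w (with_proj G)"
  from assms obtain B EB x y EF F where G: "pverts G = B \<union> F" "B \<inter> F = {}"
      "parcs G = EB \<union> {(x, y)} \<union> EF" and B: "thread (EB\<inverse>) B x" and F: "thread EF F y"
    unfolding hinged_def by blast
  obtain p q where p: "p \<noteq> []" "q \<noteq> []" "last p = x" "hd q = y"
    "set (vwalk_arcs p) \<subseteq> EB" "set (vwalk_arcs q) \<subseteq> EF" "sublist v (p @ q)"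
    using hinge_extend[OF B F G(2), of v] v G by (auto simp: vwalk_def)
  obtain p' q' where p': "p' \<noteq> []" "q' \<noteq> []" "last p' = x" "hd q' = y"
    "set (vwalk_arcs p') \<subseteq> EB" "set (vwalk_arcs q') \<subseteq> EF" "sublist w (p' @ q')"
    using hinge_extend[OF B F G(2), of w] w G by (auto simp: vwalk_def)
  have "prefix (rev p) (rev p') \<or> prefix (rev p') (rev p)"
    using p p' B
    by (intro single_valued_walks_comparable[of "EB\<inverse>"])
      (auto simp: thread_def set_vwalk_arcs_rev hd_rev)
  then have sp: "suffix p p' \<or> suffix p' p" by (simp add: suffix_to_prefix)
  obtain p'' where p'': "p'' \<noteq> []" "last p'' = x" "set (vwalk_arcs p'') \<subseteq> EB" "suffix p p''" "suffix p' p''"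
    using sp p p' by blast
  have sq: "prefix q q' \<or> prefix q' q"
    using p p' F by (intro single_valued_walks_comparable[of EF]) (auto simp: thread_def)
  obtain q'' where q'': "q'' \<noteq> []" "hd q'' = y" "set (vwalk_arcs q'') \<subseteq> EF" "prefix q q''" "prefix q' q''"
    using sq p p' by blast
  have emb: "sublist (c @ d) (p'' @ q'')" if "suffix c p''" "prefix d q''" for c d
    using that by (auto simp: suffix_def prefix_def sublist_def) (metis append.assoc)
  have "set p'' \<subseteq> B"
    using B p'' by (intro set_walk_subset_last[of EB]) (auto simp: thread_def)
  moreover have "set q'' \<subseteq> F"
    using F q'' by (intro set_walk_subset[of EF]) (auto simp: thread_def)
  ultimately have "vwalk (p'' @ q'') (with_proj G)"
    using p'' q'' G by (intro vwalkI) (auto simp: vwalk_arcs_append)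
  then show "\<exists>r. vwalk r (with_proj G) \<and> sublist v r \<and> sublist w r"
    using emb[of p q] emb[of p' q'] p p' p'' q'' by (metis sublist_order.order_trans)
qed

section \<open>Joint embedding forces a hinge\<close>

text \<open>A second occurrence of the arc, at a later position, would yield a walk from \<open>y\<close> back to \<open>x\<close>.\<close>

lemma crossing_position_unique:
  assumes "set (vwalk_arcs (a @ x # y # b)) \<subseteq> E" "set (vwalk_arcs (a' @ x # y # b')) \<subseteq> E"
    and "(y, x) \<notin> E\<^sup>*" "a @ x # y # b = a' @ x # y # b'"
  shows "a = a' \<and> b = b'"
proof -
  have no_shift: "us = []" if "us @ x # y # d' = x # y # d" "set (vwalk_arcs (c @ x # y # d)) \<subseteq> E" for us c d d'
  proof (cases us)
    case (Cons z us')
    with that(1) have "x \<in> set (y # d)" by (metis append_Cons in_set_conv_decomp list.inject)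
    moreover have "set (vwalk_arcs (y # d)) \<subseteq> E"
      by (rule walk_sublist[OF that(2)]) (auto simp: sublist_def intro: exI[of _ "c @ [x]"])
    ultimately have "(y, x) \<in> E\<^sup>*" using hd_reaches[of "y # d" E x] by simp
    with assms(3) show ?thesis by blast
  qed
  from assms(4) obtain us where
    "a = a' @ us \<and> us @ x # y # b = x # y # b' \<or> a @ us = a' \<and> x # y # b = us @ x # y # b'"
    by (auto simp: append_eq_append_conv2)
  then show ?thesis
  proof
    assume h: "a = a' @ us \<and> us @ x # y # b = x # y # b'"
    with no_shift[of us b b' a'] assms(2) have "us = []" by blast
    with h show ?thesis by simp
  next
    assume h: "a @ us = a' \<and> x # y # b = us @ x # y # b'"
    with no_shift[of us b' b a] assms(1) have "us = []" by metis
    with h show ?thesis by auto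
  qed
qed

text \<open>A jointly embeddable digraph that is not strongly connected is cut apart at an arc that no walk can
  undo; everything that follows from such an arc is collected here.\<close>

locale crossing_arc =
  fixes G :: "'v pair_pre_digraph" and x y :: 'v
  assumes wf: "parcs G \<subseteq> pverts G \<times> pverts G"
    and joint: "joint_walks G"
    and arc: "(x, y) \<in> parcs G"
    and no_return: "(y, x) \<notin> (parcs G)\<^sup>*"
begin

lemma vwalkI_arcs:
  assumes "p \<noteq> []" "hd p \<in> pverts G" "set (vwalk_arcs p) \<subseteq> parcs G"
  shows "vwalk p (with_proj G)"
  using assms set_walk_subset[OF wf assms(3,2)] by (intro vwalkI) auto

text \<open>A common walk contains the arc only once, so the two occurrences are superimposed in it. This is
  the only way in which joint embedding is used to restrict the local structure of the digraph.\<close>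

lemma aligned:
  assumes "vwalk (a @ x # y # b) (with_proj G)" "vwalk (a' @ x # y # b') (with_proj G)"
  shows "suffix a a' \<or> suffix a' a" "prefix b b' \<or> prefix b' b"
proof -
  from joint assms obtain r where r: "vwalk r (with_proj G)"
      "sublist (a @ x # y # b) r" "sublist (a' @ x # y # b') r"
    unfolding joint_walks_def by blast
  from r(2) obtain l m where lm: "r = (l @ a) @ x # y # (b @ m)" by (auto simp: sublist_def)
  from r(3) obtain l' m' where lm': "r = (l' @ a') @ x # y # (b' @ m')" by (auto simp: sublist_def)
  have "l @ a = l' @ a' \<and> b @ m = b' @ m'"
  proof (rule crossing_position_unique[of _ x y _ "parcs G"])
    show "set (vwalk_arcs ((l @ a) @ x # y # (b @ m))) \<subseteq> parcs G"
      using r(1) unfolding lm by (auto simp: vwalk_def)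
    show "set (vwalk_arcs ((l' @ a') @ x # y # (b' @ m'))) \<subseteq> parcs G"
      using r(1) unfolding lm' by (auto simp: vwalk_def)
    show "(l @ a) @ x # y # (b @ m) = (l' @ a') @ x # y # (b' @ m')"
      using lm lm' by simp
  qed (rule no_return)
  then show "suffix a a' \<or> suffix a' a" "prefix b b' \<or> prefix b' b"
    by (metis suffixI suffix_same_cases, metis prefixI prefix_same_cases)
qed

text \<open>Embedding a walk jointly with the single arc \<open>(x, y)\<close> locates it relative to that arc.\<close>

lemma joined_with_arc:
  assumes "vwalk p (with_proj G)"
  obtains l m where "sublist p (l @ x # y # m)"
    "\<And>v. v \<in> set l \<union> {x} \<Longrightarrow> (v, x) \<in> (parcs G)\<^sup>*"
    "\<And>v. v \<in> set m \<union> {y} \<Longrightarrow> (y, v) \<in> (parcs G)\<^sup>*"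
proof -
  have "vwalk [x, y] (with_proj G)" using arc wf by (auto simp: vwalk_def)
  with joint assms obtain r where r: "vwalk r (with_proj G)" "sublist p r" "sublist [x, y] r"
    unfolding joint_walks_def by blast
  from r(3) obtain l m where lm: "r = l @ x # y # m" by (auto simp: sublist_def)
  have arcs: "set (vwalk_arcs r) \<subseteq> parcs G" using r(1) by (auto simp: vwalk_def)
  have "set (vwalk_arcs (l @ [x])) \<subseteq> parcs G" "set (vwalk_arcs (y # m)) \<subseteq> parcs G"
    using set_vwalk_arcs_append1[of "l @ [x]" "y # m"] set_vwalk_arcs_append2[of "y # m" "l @ [x]"]
      arcs lm by auto
  then show thesis
    using that[of l m] r lm reaches_last[of "l @ [x]" "parcs G"] hd_reaches[of "y # m" "parcs G"]
    by simp
qed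

lemma before_or_after:
  assumes "w \<in> pverts G"
  shows "(w, x) \<in> (parcs G)\<^sup>* \<or> (y, w) \<in> (parcs G)\<^sup>*"
proof -
  have "vwalk [w] (with_proj G)" using assms by (auto simp: vwalk_def)
  then obtain l m where lm: "sublist [w] (l @ x # y # m)"
      "\<And>v. v \<in> set l \<union> {x} \<Longrightarrow> (v, x) \<in> (parcs G)\<^sup>*"
      "\<And>v. v \<in> set m \<union> {y} \<Longrightarrow> (y, v) \<in> (parcs G)\<^sup>*"
    using joined_with_arc by metis
  have "w \<in> set (l @ x # y # m)" using set_mono_sublist[OF lm(1)] by simp
  with lm(2,3) show ?thesis by auto
qed

lemma only_crossing:
  assumes "(c, d) \<in> parcs G" "(c, x) \<in> (parcs G)\<^sup>*" "(y, d) \<in> (parcs G)\<^sup>*"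
  shows "(c, d) = (x, y)"
proof -
  have "vwalk [c, d] (with_proj G)" using assms(1) wf by (auto simp: vwalk_def)
  then obtain l m where lm: "sublist [c, d] (l @ x # y # m)"
      "\<And>v. v \<in> set l \<union> {x} \<Longrightarrow> (v, x) \<in> (parcs G)\<^sup>*"
      "\<And>v. v \<in> set m \<union> {y} \<Longrightarrow> (y, v) \<in> (parcs G)\<^sup>*"
    using joined_with_arc by metis
  have "(c, d) \<in> set (vwalk_arcs (l @ x # y # m))"
    using walk_sublist[OF subset_refl lm(1)] by simp
  also have "l @ x # y # m = (l @ [x]) @ (y # m)" by simp
  finally have "(c, d) \<in> set (vwalk_arcs (l @ [x])) \<union> {(x, y)} \<union> set (vwalk_arcs (y # m))"
    by (subst (asm) vwalk_arcs_append) auto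
  moreover have "(c, d) \<notin> set (vwalk_arcs (l @ [x]))"
  proof
    assume "(c, d) \<in> set (vwalk_arcs (l @ [x]))"
    then have "d \<in> set l \<union> {x}" using arcs_in_vwalk_arcs by fastforce
    then have "(d, x) \<in> (parcs G)\<^sup>*" by (rule lm(2))
    with assms(3) no_return show False by (meson rtrancl_trans)
  qed
  moreover have "(c, d) \<notin> set (vwalk_arcs (y # m))"
  proof
    assume "(c, d) \<in> set (vwalk_arcs (y # m))"
    then have "c \<in> set m \<union> {y}" using arcs_in_vwalk_arcs by fastforce
    then have "(y, c) \<in> (parcs G)\<^sup>*" by (rule lm(3))
    with assms(2) no_return show False by (meson rtrancl_trans)
  qed
  ultimately show ?thesis by blast
qed

text \<open>Two predecessors \<open>c\<close>, \<open>c'\<close> of \<open>d\<close> start two walks \<open>c, d, ..., x, y\<close> that differ only in their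
  first vertex. They have the same length up to the arc \<open>(x, y)\<close>, so alignment identifies them.\<close>

lemma unique_predecessor:
  assumes "(c, d) \<in> parcs G" "(c', d) \<in> parcs G" "(d, x) \<in> (parcs G)\<^sup>*"
  shows "c = c'"
proof -
  obtain s where s: "s \<noteq> []" "hd s = d" "last s = x" "set (vwalk_arcs s) \<subseteq> parcs G"
    using assms(3) by (rule walk_of_rtrancl)
  then have snoc: "s = butlast s @ [x]" by (metis append_butlast_last_id)
  have "vwalk ((e # butlast s) @ x # y # []) (with_proj G)" if "(e, d) \<in> parcs G" for e
  proof (rule vwalkI_arcs)
    have "vwalk_arcs ((e # s) @ [y]) = vwalk_arcs (e # s) @ [(x, y)]"
      using s by (subst vwalk_arcs_append) auto
    moreover have "(e # butlast s) @ x # y # [] = (e # s) @ [y]"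
      by (subst (2) snoc) simp
    moreover have "set (vwalk_arcs (e # s) @ [(x, y)]) \<subseteq> parcs G"
      using s that arc by simp
    ultimately show "set (vwalk_arcs ((e # butlast s) @ x # y # [])) \<subseteq> parcs G"
      by metis
  qed (use that wf in auto)
  \<comment> \<open>Suffixes of one another and of equal length, the two initial parts coincide.\<close>
  from aligned(1)[OF this[OF assms(1)] this[OF assms(2)]] show ?thesis
    by (auto simp: suffix_def append_eq_append_conv2 Cons_eq_append_conv)
qed

lemma unique_successor:
  assumes "(d, c) \<in> parcs G" "(d, c') \<in> parcs G" "(y, d) \<in> (parcs G)\<^sup>*"
  shows "c = c'"
proof -
  obtain s where s: "s \<noteq> []" "hd s = y" "last s = d" "set (vwalk_arcs s) \<subseteq> parcs G"
    using assms(3) by (rule walk_of_rtrancl)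
  then have cons: "s = y # tl s" by (metis list.collapse)
  have "vwalk ([] @ x # y # (tl s @ [e])) (with_proj G)" if "(d, e) \<in> parcs G" for e
  proof (rule vwalkI_arcs)
    have "vwalk_arcs (x # s @ [e]) = (x, y) # vwalk_arcs s @ [(d, e)]"
      using s by (simp add: vwalk_arcs_append)
    moreover have "[] @ x # y # (tl s @ [e]) = x # s @ [e]"
      by (subst (2) cons) simp
    moreover have "set ((x, y) # vwalk_arcs s @ [(d, e)]) \<subseteq> parcs G"
      using s that arc by simp
    ultimately show "set (vwalk_arcs ([] @ x # y # (tl s @ [e]))) \<subseteq> parcs G"
      by metis
  qed (use arc wf in auto)
  from aligned(2)[OF this[OF assms(1)] this[OF assms(2)]] show ?thesis by auto
qed

lemma hinged: "hinged G"
proof -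
  let ?E = "parcs G"
  let ?B = "{w \<in> pverts G. (w, x) \<in> ?E\<^sup>*}" and ?F = "{w \<in> pverts G. (y, w) \<in> ?E\<^sup>*}"
  let ?EB = "?E \<inter> ?B \<times> ?B" and ?EF = "?E \<inter> ?F \<times> ?F"
  have xy: "x \<in> ?B" "y \<in> ?F" using arc wf by auto
  have disj: "?B \<inter> ?F = {}" using no_return by (auto dest: rtrancl_trans)
  have un: "pverts G = ?B \<union> ?F" using before_or_after by auto
  have pred_in: "c \<in> ?B" if "(c, d) \<in> ?E" "d \<in> ?B" for c d
    using that wf by (auto intro: converse_rtrancl_into_rtrancl)
  have succ_in: "d \<in> ?F" if "(c, d) \<in> ?E" "c \<in> ?F" for c d
    using that wf by (auto intro: rtrancl_into_rtrancl)
  have "?E \<subseteq> ?EB \<union> {(x, y)} \<union> ?EF"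
  proof
    fix a assume a: "a \<in> ?E"
    obtain c d where cd: "a = (c, d)" by force
    have "c \<in> ?B \<or> c \<in> ?F" "d \<in> ?B \<or> d \<in> ?F" using a cd un wf by blast+
    then consider "d \<in> ?B" | "c \<in> ?F" | "c \<in> ?B" "d \<in> ?F" by blast
    then show "a \<in> ?EB \<union> {(x, y)} \<union> ?EF"
    proof cases
      case 1 with pred_in[of c d] a cd show ?thesis by blast
    next
      case 2 with succ_in[of c d] a cd show ?thesis by blast
    next
      case 3 with only_crossing[of c d] a cd show ?thesis by blast
    qed
  qed
  with arc have split: "?E = ?EB \<union> {(x, y)} \<union> ?EF" by blast
  have reachB: "(v, x) \<in> ?EB\<^sup>*" if "v \<in> ?B" for v
  proof -
    from that have "(v, x) \<in> ?E\<^sup>*" by blast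
    then show ?thesis
    proof (induction rule: converse_rtrancl_induct)
      case (step c d)
      then have "d \<in> ?B" using wf by blast
      with pred_in step have "(c, d) \<in> ?EB" by blast
      with step.IH show ?case by (rule converse_rtrancl_into_rtrancl[rotated])
    qed simp
  qed
  have reachF: "(y, v) \<in> ?EF\<^sup>*" if "v \<in> ?F" for v
  proof -
    from that have "(y, v) \<in> ?E\<^sup>*" by blast
    then show ?thesis
    proof (induction rule: rtrancl_induct)
      case (step c d)
      then have "c \<in> ?F" using wf by blast
      with succ_in step have "(c, d) \<in> ?EF" by blast
      with step.IH show ?case by (rule rtrancl_into_rtrancl)
    qed simp
  qed
  have "single_valued (?EB\<inverse>)" "single_valued ?EF"
    using unique_predecessor unique_successor by (auto intro!: single_valuedI)
  then have "thread (?EB\<inverse>) ?B x" "thread ?EF ?F y"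
    using xy reachB reachF by (auto simp: thread_def rtrancl_converse)
  with un disj split show ?thesis unfolding hinged_def by blast
qed

end

text \<open>Joint embedding of single vertices makes reachability total. If it is not symmetric, some
  arc cannot be reversed, for otherwise reachability would be symmetric as well.\<close>

lemma joint_walks_imp_hinged:
  assumes wf: "parcs G \<subseteq> pverts G \<times> pverts G" and ne: "pverts G \<noteq> {}"
    and joint: "joint_walks G" and nsc: "\<not> strongly_connected (with_proj G)"
  shows "hinged G"
proof -
  let ?E = "parcs G"
  from nsc ne obtain u v where uv: "u \<in> pverts G" "v \<in> pverts G" "(u, v) \<notin> ?E\<^sup>*"
    by (auto simp: strongly_connected_with_proj_iff[OF wf])
  have "vwalk [u] (with_proj G)" "vwalk [v] (with_proj G)" using uv by (auto simp: vwalk_def)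
  with joint obtain r where r: "vwalk r (with_proj G)" "sublist [u] r" "sublist [v] r"
    unfolding joint_walks_def by blast
  from r(2) obtain l m where lm: "r = l @ u # m" by (auto simp: sublist_def)
  have arcs: "set (vwalk_arcs r) \<subseteq> ?E" using r(1) by (auto simp: vwalk_def)
  have "set (vwalk_arcs (l @ [u])) \<subseteq> ?E" "set (vwalk_arcs (u # m)) \<subseteq> ?E"
    using set_vwalk_arcs_append1[of "l @ [u]" m] set_vwalk_arcs_append2[of "u # m" l] arcs lm
    by auto
  moreover have "v \<in> set (l @ u # m)" using set_mono_sublist[OF r(3)] lm by simp
  ultimately have "(v, u) \<in> ?E\<^sup>* \<or> (u, v) \<in> ?E\<^sup>*"
    using reaches_last[of "l @ [u]" ?E v] hd_reaches[of "u # m" ?E v] by auto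
  with uv(3) have vu: "(v, u) \<in> ?E\<^sup>*" by blast
  have "\<exists>x y. (x, y) \<in> ?E \<and> (y, x) \<notin> ?E\<^sup>*"
  proof (rule ccontr)
    assume "\<not> ?thesis"
    then have "?E\<inverse> \<subseteq> ?E\<^sup>*" by blast
    then have "(?E\<inverse>)\<^sup>* \<subseteq> ?E\<^sup>*" using rtrancl_subset_rtrancl by blast
    with vu uv(3) show False by (auto simp: rtrancl_converse)
  qed
  then obtain x y where "(x, y) \<in> ?E" "(y, x) \<notin> ?E\<^sup>*" by blast
  with wf joint interpret crossing_arc G x y by unfold_locales
  show ?thesis by (rule hinged)
qed

section \<open>Deterministic digraphs are lollipops\<close>

text \<open>The properties of a simple cycle that depend on its vertex list alone, so that they can be used
  for the whole digraph, for a piece of it, and for a piece with reversed arcs.\<close>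

definition closed_cycle :: "'v list \<Rightarrow> bool" where
  "closed_cycle q \<longleftrightarrow> 2 \<le> length q \<and> hd q = last q \<and> distinct (butlast q)"

text \<open>A path \<open>t\<close> that runs into a cycle \<open>q\<close>, or just stops if \<open>q\<close> is empty: one half of a bicycle.\<close>

definition lollipop :: "'v list \<Rightarrow> 'v list \<Rightarrow> bool" where
  "lollipop t q \<longleftrightarrow> t \<noteq> [] \<and> distinct t \<and> (q = [] \<or> closed_cycle q) \<and>
     (q \<noteq> [] \<longrightarrow> last t \<in> set q) \<and> set (butlast t) \<inter> set q = {}"

lemma closed_cycle_rev: "closed_cycle (rev q) \<longleftrightarrow> closed_cycle q"
proof -
  have "closed_cycle (rev q)" if q: "closed_cycle q" for q :: "'a list"
  proof -
    obtain c m where "q = c # m @ [c]"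
    proof -
      obtain c m' where 1: "q = c # m'" "m' \<noteq> []"
        using q by (cases q; cases "tl q") (auto simp: closed_cycle_def)
      then have "m' = butlast m' @ [c]" using q by (auto simp: closed_cycle_def)
      with 1 that show thesis by metis
    qed
    with q show ?thesis by (simp add: closed_cycle_def butlast_append)
  qed
  from this[of q] this[of "rev q"] show ?thesis by auto
qed

lemma arc_tail_in_butlast: "(v, w) \<in> set (vwalk_arcs p) \<Longrightarrow> v \<in> set (butlast p)"
  by (induction p rule: vwalk_arcs.induct) (auto split: if_splits)

lemma not_last_has_successor:
  "v \<in> set p \<Longrightarrow> v \<noteq> last p \<Longrightarrow> \<exists>w. (v, w) \<in> set (vwalk_arcs p)"
  by (induction p rule: vwalk_arcs.induct) (auto split: if_splits)

lemma single_valued_walk: "distinct (butlast p) \<Longrightarrow> single_valued (set (vwalk_arcs p))"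
proof (induction p rule: vwalk_arcs.induct)
  case (3 x y xs)
  then show ?case
    using arc_tail_in_butlast[of x _ "y # xs"] by (auto simp: single_valued_def)
qed auto

lemma vwalk_arcs_split:
  "set (vwalk_arcs (a @ z # b)) = set (vwalk_arcs (a @ [z])) \<union> set (vwalk_arcs (z # b))"
  by (induction a rule: vwalk_arcs.induct) auto

lemma lollipop_imp_thread:
  assumes "lollipop t q"
  shows "thread (set (vwalk_arcs t) \<union> set (vwalk_arcs q)) (set t \<union> set q) (hd t)"
proof -
  let ?E = "set (vwalk_arcs t) \<union> set (vwalk_arcs q)"
  note l = assms[unfolded lollipop_def closed_cycle_def]
  have t: "(hd t, v) \<in> ?E\<^sup>*" if "v \<in> set t" for v
    using hd_reaches[of t ?E v] that by simp
  have q: "(hd t, v) \<in> ?E\<^sup>*" if "v \<in> set q" for v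
  proof -
    from that l have "last t \<in> set q" "hd q = last q" by auto
    then have "(last t, hd q) \<in> ?E\<^sup>*" "(hd q, v) \<in> ?E\<^sup>*"
      using reaches_last[of q ?E "last t"] hd_reaches[of q ?E v] that by auto
    moreover have "(hd t, last t) \<in> ?E\<^sup>*" using l by (intro t) auto
    ultimately show ?thesis by (meson rtrancl_trans)
  qed
  have "single_valued (set (vwalk_arcs t))" "single_valued (set (vwalk_arcs q))"
    using l by (auto intro!: single_valued_walk simp: distinct_butlast)
  moreover have "v \<in> set (butlast t)" if "(v, w) \<in> set (vwalk_arcs t)" for v w
    using that by (rule arc_tail_in_butlast)
  moreover have "v \<in> set q" if "(v, w) \<in> set (vwalk_arcs q)" for v w
    using that arcs_in_vwalk_arcs by fastforce
  ultimately have "single_valued ?E"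
    using l unfolding single_valued_def by blast
  moreover have "?E \<subseteq> (set t \<union> set q) \<times> (set t \<union> set q)"
    using arcs_in_vwalk_arcs[of _ t] arcs_in_vwalk_arcs[of _ q] by blast
  ultimately show ?thesis using l t q by (auto simp: thread_def)
qed

text \<open>A longest simple path from \<open>y\<close> visits everything: the only successor of an inner vertex is the next
  vertex on the path, and a successor of the last vertex must already be on the path by maximality. If
  the last vertex has a successor \<open>z\<close>, the path is cut at \<open>z\<close> into the stick and the cycle.\<close>

lemma thread_imp_lollipop:
  assumes "thread E S y" "finite S"
  obtains t q where "lollipop t q" "hd t = y" "S = set t \<union> set q"
    "E = set (vwalk_arcs t) \<union> set (vwalk_arcs q)"
proof -
  have th: "y \<in> S" "E \<subseteq> S \<times> S" "\<And>v. v \<in> S \<Longrightarrow> (y, v) \<in> E\<^sup>*" "single_valued E"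
    using assms(1) by (auto simp: thread_def)
  let ?P = "\<lambda>p. p \<noteq> [] \<and> distinct p \<and> hd p = y \<and> set (vwalk_arcs p) \<subseteq> E"
  have "length p \<le> card S" if "?P p" for p
    using that th set_walk_subset[of E S p] assms(2) by (metis card_mono distinct_card)
  then have "\<forall>p. ?P p \<longrightarrow> length p < Suc (card S)" by (auto simp: less_Suc_eq_le)
  moreover have "?P [y]" by simp
  ultimately obtain p where p: "?P p" and max: "\<And>p'. ?P p' \<Longrightarrow> length p' \<le> length p"
    using ex_has_greatest_nat[of ?P "[y]" length "Suc (card S)"] by blast
  have inner: "(v, w) \<in> set (vwalk_arcs p)" if vw: "v \<in> set p" "v \<noteq> last p" "(v, w) \<in> E" for v w
  proof -
    from not_last_has_successor[OF vw(1,2)] obtain w' where w': "(v, w') \<in> set (vwalk_arcs p)" ..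
    with p vw(3) th(4) have "w = w'" by (auto dest: single_valuedD)
    with w' show ?thesis by simp
  qed
  have final: "w \<in> set p" if w: "(last p, w) \<in> E" for w
  proof (rule ccontr)
    assume "w \<notin> set p"
    then have "?P (p @ [w])" using p w by (auto simp: vwalk_arcs_append)
    from max[OF this] show False by simp
  qed
  have step: "w \<in> set p" if "v \<in> set p" "(v, w) \<in> E" for v w
    using inner[OF that(1) _ that(2)] final that(2) arcs_in_vwalk_arcs[of "(v, w)" p] by blast
  have "v \<in> set p" if "(y, v) \<in> E\<^sup>*" for v
    using that
  proof (induction rule: rtrancl_induct)
    case base
    show ?case using p by auto
  qed (use step in blast)
  then have S: "S = set p"
    using th(3) set_walk_subset[OF th(2), of p] p th(1) by auto
  show thesis
  proof (cases "\<exists>z. (last p, z) \<in> E")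
    case False
    have "E = set (vwalk_arcs p)"
      using inner False th(2) S p by auto
    with S p show thesis by (intro that[of p "[]"]) (auto simp: lollipop_def)
  next
    case True
    then obtain z where z: "(last p, z) \<in> E" by blast
    with final obtain a b where ab: "p = a @ z # b" by (metis split_list)
    have cyc: "set (vwalk_arcs (z # b @ [z])) = insert (last p, z) (set (vwalk_arcs (z # b)))"
      using set_vwalk_arcs_snoc[of "z # b" z] ab by simp
    have "E \<subseteq> insert (last p, z) (set (vwalk_arcs p))"
    proof
      fix e assume "e \<in> E"
      moreover obtain v w where "e = (v, w)" by force
      ultimately have vw: "(v, w) \<in> E" "e = (v, w)" "v \<in> set p" using th(2) S by auto
      show "e \<in> insert (last p, z) (set (vwalk_arcs p))"
      proof (cases "v = last p")
        case True
        with vw z th(4) show ?thesis by (auto dest: single_valuedD)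
      qed (use inner vw in simp)
    qed
    then have "E = set (vwalk_arcs (a @ [z])) \<union> set (vwalk_arcs (z # b @ [z]))"
      unfolding cyc using p z ab vwalk_arcs_split[of a z b] by auto
    moreover have "lollipop (a @ [z]) (z # b @ [z])"
      using p ab by (auto simp: lollipop_def closed_cycle_def)
    moreover have "hd (a @ [z]) = y" using p ab by (cases a) auto
    ultimately show thesis using S ab by (intro that) auto
  qed
qed

section \<open>Hinged digraphs and bicycles\<close>

lemma hinged_imp_bicycle:
  assumes "finite (pverts G)" "hinged G"
  shows "bicycle G"
proof -
  from assms(2) obtain B EB x y EF F where G: "pverts G = B \<union> F" "B \<inter> F = {}"
      "parcs G = EB \<union> {(x, y)} \<union> EF" and B: "thread (EB\<inverse>) B x" and F: "thread EF F y"
    unfolding hinged_def by blast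
  obtain s p where s: "lollipop s p" "hd s = x" "B = set s \<union> set p"
      and EB': "EB\<inverse> = set (vwalk_arcs s) \<union> set (vwalk_arcs p)"
    using thread_imp_lollipop[OF B] assms(1) G(1) by (metis finite_Un)
  obtain t q where t: "lollipop t q" "hd t = y" "F = set t \<union> set q"
      and EF: "EF = set (vwalk_arcs t) \<union> set (vwalk_arcs q)"
    using thread_imp_lollipop[OF F] assms(1) G(1) by (metis finite_Un)
  have EB: "EB = set (vwalk_arcs (rev s)) \<union> set (vwalk_arcs (rev p))"
    using EB' by (auto simp: set_vwalk_arcs_rev)
  let ?t = "rev s @ t"
  note l = s(1)[unfolded lollipop_def] t(1)[unfolded lollipop_def]
  have arcs_t: "set (vwalk_arcs ?t) = set (vwalk_arcs (rev s)) \<union> {(x, y)} \<union> set (vwalk_arcs t)"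
    using l s(2) t(2) by (auto simp: vwalk_arcs_append last_rev)
  have cyc: "simple_cycle c G" if "closed_cycle c" "set c \<subseteq> pverts G" "set (vwalk_arcs c) \<subseteq> parcs G" for c
    using that by (auto simp: simple_cycle_def closed_cycle_def vwalk_def)
  have tls: "tl ?t = rev (butlast s) @ t" using l by (cases s rule: rev_cases) auto
  show ?thesis
    unfolding bicycle_def
  proof (intro exI conjI)
    show "rev p = [] \<or> simple_cycle (rev p) G"
      using l closed_cycle_rev[of p] cyc[of "rev p"] G s EB by auto
    show "q = [] \<or> simple_cycle q G" using l cyc[of q] G t EF by auto
    show "vpath ?t (with_proj G)"
      using l G s t EB EF arcs_t by (auto simp: vpath_def vwalk_def)
    show "set (rev p) \<inter> set q = {}" using G(2) s t by auto
    show "rev p \<noteq> [] \<longrightarrow> hd ?t \<in> set (rev p)" using l by (auto simp: hd_rev)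
    show "set (tl ?t) \<inter> set (rev p) = {}" unfolding tls using l G(2) s t by auto
    show "q \<noteq> [] \<longrightarrow> last ?t \<in> set q" using l by auto
    show "set (butlast ?t) \<inter> set q = {}" using l G(2) s t by (auto simp: butlast_append)
    show "pverts G = set (rev p) \<union> set ?t \<union> set q" using G s t by auto
    show "parcs G = set (vwalk_arcs (rev p)) \<union> set (vwalk_arcs ?t) \<union> set (vwalk_arcs q)"
      unfolding arcs_t G(3) EB EF by auto
  qed
qed

text \<open>If the connecting path has an arc, its first arc is a hinge: on the initial side lies the initial
  cycle with the first vertex of the path, on the other side the rest of the path with the terminal cycle.
  If it is a single vertex, the two cycles cannot both be present, as they would share that vertex.\<close>

lemma bicycle_imp_strongly_connected_or_hinged:
  assumes wf: "parcs G \<subseteq> pverts G \<times> pverts G" and "bicycle G"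
  shows "strongly_connected (with_proj G) \<or> hinged G"
proof -
  from assms(2) obtain p t q where
      pcyc: "p = [] \<or> simple_cycle p G" and qcyc: "q = [] \<or> simple_cycle q G"
      and path: "vpath t (with_proj G)" and pq: "set p \<inter> set q = {}"
      and pt: "p \<noteq> [] \<longrightarrow> hd t \<in> set p" "set (tl t) \<inter> set p = {}"
      and qt: "q \<noteq> [] \<longrightarrow> last t \<in> set q" "set (butlast t) \<inter> set q = {}"
      and V: "pverts G = set p \<union> set t \<union> set q"
      and E: "parcs G = set (vwalk_arcs p) \<union> set (vwalk_arcs t) \<union> set (vwalk_arcs q)"
    unfolding bicycle_def by metis
  have p: "p = [] \<or> closed_cycle p" and q: "q = [] \<or> closed_cycle q"
    using pcyc qcyc by (auto simp: simple_cycle_def closed_cycle_def)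
  have t: "t \<noteq> []" "distinct t" using path by (auto simp: vpath_def vwalk_def)
  obtain x s where xs: "t = x # s" using t by (cases t) auto
  show ?thesis
  proof (cases "s = []")
    case True
    have cycle_sc: "strongly_connected (with_proj G)"
      if c: "closed_cycle c" "pverts G = set c" "parcs G = set (vwalk_arcs c)" for c
    proof -
      have "(u, v) \<in> (parcs G)\<^sup>*" if "u \<in> set c" "v \<in> set c" for u v
      proof -
        have "(u, last c) \<in> (parcs G)\<^sup>*" "(hd c, v) \<in> (parcs G)\<^sup>*"
          using reaches_last[of c _ u] hd_reaches[of c _ v] that c(3) by simp_all
        moreover have "hd c = last c" using c(1) by (simp add: closed_cycle_def)
        ultimately show ?thesis by (metis rtrancl_trans)
      qed
      then show ?thesis
        using c by (auto simp: strongly_connected_with_proj_iff[OF wf] closed_cycle_def)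
    qed
    have "p = [] \<or> q = []" using pt(1) qt(1) pq xs True by auto
    then consider "p = []" "q = []" | "p \<noteq> []" "q = []" | "p = []" "q \<noteq> []" by blast
    then show ?thesis
    proof cases
      case 1
      then show ?thesis
        using V xs True by (simp add: strongly_connected_with_proj_iff[OF wf])
    next
      case 2
      then show ?thesis using cycle_sc[of p] p pt(1) V E xs True by auto
    next
      case 3
      then show ?thesis using cycle_sc[of q] q qt(1) V E xs True by auto
    qed
  next
    case False
    let ?EB = "set (vwalk_arcs p)" and ?EF = "set (vwalk_arcs s) \<union> set (vwalk_arcs q)"
    have "lollipop [x] (rev p)" using p pt xs by (auto simp: lollipop_def closed_cycle_rev)
    from lollipop_imp_thread[OF this] have "thread (?EB\<inverse>) (insert x (set p)) x"
      by (simp add: set_vwalk_arcs_rev converse_unfold)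
    moreover have "lollipop s q" using q qt t xs False by (auto simp: lollipop_def)
    from lollipop_imp_thread[OF this] have "thread ?EF (set s \<union> set q) (hd s)" .
    moreover have "pverts G = insert x (set p) \<union> (set s \<union> set q)" using V xs by auto
    moreover have "insert x (set p) \<inter> (set s \<union> set q) = {}"
      using pq pt(2) qt(2) t xs False by auto
    moreover have "parcs G = ?EB \<union> {(x, hd s)} \<union> ?EF" using E xs False by auto
    ultimately show ?thesis unfolding hinged_def by blast
  qed
qed

theorem joint_walks_iff:
  assumes wf: "parcs G \<subseteq> pverts G \<times> pverts G" and "finite (pverts G)" "pverts G \<noteq> {}"
  shows "joint_walks G \<longleftrightarrow> strongly_connected (with_proj G) \<or> bicycle G"
proof
  assume "joint_walks G"
  then show "strongly_connected (with_proj G) \<or> bicycle G"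
    using joint_walks_imp_hinged[OF wf assms(3)] hinged_imp_bicycle[OF assms(2)] by blast
next
  assume "strongly_connected (with_proj G) \<or> bicycle G"
  then have "strongly_connected (with_proj G) \<or> hinged G"
    using bicycle_imp_strongly_connected_or_hinged[OF wf] by blast
  then show "joint_walks G"
    using strongly_connected_imp_joint_walks[OF wf] hinged_imp_joint_walks by blast
qed

section \<open>Words and their windows\<close>

text \<open>If \<open>u\<close> and \<open>v\<close> have no common extension in \<open>C\<close>, then \<open>C\<close> is the union of the words avoiding \<open>u\<close> and
  the words avoiding \<open>v\<close>, and these are proper downward closed subsets.\<close>

lemma atomic_set_iff_directed:
  assumes "downward_closed A C"
  shows "atomic_set A C \<longleftrightarrow> (\<forall>u\<in>C. \<forall>v\<in>C. \<exists>w\<in>C. sublist u w \<and> sublist v w)"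
proof (intro iffI ballI)
  fix u v
  assume atomic: "atomic_set A C" and uv: "u \<in> C" "v \<in> C"
  show "\<exists>w\<in>C. sublist u w \<and> sublist v w"
  proof (rule ccontr)
    assume no: "\<not> ?thesis"
    let ?avoid = "\<lambda>x. {w \<in> C. \<not> sublist x w}"
    have dc: "downward_closed A (?avoid x)" for x
      using assms unfolding downward_closed_def by (auto dest: sublist_order.order_trans)
    have "C = ?avoid u \<union> ?avoid v" using no by blast
    moreover have "?avoid u \<subset> C" "?avoid v \<subset> C" using uv by auto
    ultimately show False using atomic dc unfolding atomic_set_def by blast
  qed
next
  assume dir: "\<forall>u\<in>C. \<forall>v\<in>C. \<exists>w\<in>C. sublist u w \<and> sublist v w"
  show "atomic_set A C"
    unfolding atomic_set_def
  proof
    assume "\<exists>D E. downward_closed A D \<and> downward_closed A E \<and> D \<subset> C \<and> E \<subset> C \<and> C = D \<union> E"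
    then obtain D E where DE: "downward_closed A D" "downward_closed A E" "D \<subset> C" "E \<subset> C" "C = D \<union> E"
      by blast
    then obtain u v where uv: "u \<in> C" "u \<notin> D" "v \<in> C" "v \<notin> E" by blast
    with dir obtain w where w: "w \<in> C" "sublist u w" "sublist v w" by blast
    have "u \<in> lists A" "v \<in> lists A" using uv assms by (auto simp: downward_closed_def)
    with w uv DE(1,2) have "w \<notin> D" "w \<notin> E" unfolding downward_closed_def by auto
    with w(1) DE(5) show False by blast
  qed
qed

lemma exists_factor_basis_element:
  assumes "w \<in> lists A" "w \<notin> C"
  obtains m where "m \<in> factor_basis A C" "sublist m w"
  using assms
proof (induction w arbitrary: thesis rule: measure_induct_rule[of length])
  case (less w)
  show ?case
  proof (cases "w \<in> factor_basis A C")
    case False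
    with less.prems obtain u where u: "u \<in> lists A" "u \<notin> C" "sublist u w" "u \<noteq> w"
      by (auto simp: factor_basis_def)
    from u(3) obtain x y where "w = x @ u @ y" by (auto simp: sublist_def)
    with u(4) have "length u < length w" by (cases "x = []"; cases "y = []") auto
    then obtain m where "m \<in> factor_basis A C" "sublist m u"
      using less.IH[of u] u by blast
    with less.prems(1) u(3) show ?thesis by (meson sublist_order.order_trans)
  qed (use less.prems in auto)
qed

text \<open>The walk in the \<open>b\<close>-dimensional de Bruijn graph that corresponds to a word. It is empty for a word
  shorter than \<open>b\<close>; only words of length at least \<open>b\<close> can be recovered from it.\<close>

fun windows :: "nat \<Rightarrow> 'a list \<Rightarrow> 'a list list" where
  "windows b [] = []"
| "windows b (a # w) = (if b \<le> Suc (length w) then take b (a # w) # windows b w else [])"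

lemma windows_short: "length w < b \<Longrightarrow> windows b w = []"
  by (cases w) auto

lemma windows_eq_Nil_iff: "0 < b \<Longrightarrow> windows b w = [] \<longleftrightarrow> length w < b"
  by (cases w) auto

lemma hd_windows: "0 < b \<Longrightarrow> b \<le> length w \<Longrightarrow> hd (windows b w) = take b w"
  by (cases w) auto

lemma length_windows: "0 < b \<Longrightarrow> length (windows b w) = Suc (length w) - b"
  by (induction w) auto

lemma in_windows:
  assumes "v \<in> set (windows b w)"
  shows "length v = b \<and> sublist v w"
  using assms
proof (induction w)
  case (Cons a w)
  then consider "v = take b (a # w)" "b \<le> Suc (length w)" | "v \<in> set (windows b w)"
    by (auto split: if_splits)
  then show ?case
  proof cases
    case 1
    then show ?thesis by (simp add: prefix_imp_sublist take_is_prefix)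
  qed (use Cons in \<open>auto simp: sublist_Cons_right\<close>)
qed simp

lemma factor_in_window:
  assumes "sublist m w" "length m \<le> b" "b \<le> length w" "0 < b"
  shows "\<exists>v \<in> set (windows b w). sublist m v"
  using assms
proof (induction w)
  case (Cons a w)
  have W: "windows b (a # w) = take b (a # w) # windows b w" using Cons.prems by simp
  show ?case
  proof (cases "prefix m (a # w)")
    case True
    then have "prefix m (take b (a # w))"
      using Cons.prems by (metis take_is_prefix length_take min.absorb2 prefix_length_prefix)
    then show ?thesis unfolding W by auto
  next
    case False
    then have m: "sublist m w" using Cons.prems by (simp add: sublist_Cons_right)
    show ?thesis
    proof (cases "b \<le> length w")
      case True
      with Cons m show ?thesis unfolding W by auto
    next
      case False
      then have "take b (a # w) = a # w" using Cons.prems by simp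
      with W Cons.prems show ?thesis by auto
    qed
  qed
qed simp

text \<open>Each window contributes its first letter, and the last window contributes all of its letters.\<close>

lemma windows_inj:
  assumes "windows b u = windows b w" "0 < b" "b \<le> length u" "b \<le> length w"
  shows "u = w"
  using assms
proof (induction u arbitrary: w)
  case (Cons a u)
  then obtain c w' where w: "w = c # w'" by (cases w) auto
  have eq: "take b (a # u) = take b (c # w')" "windows b u = windows b w'"
    using Cons.prems w by auto
  then have "a = c" using Cons.prems by (cases b) auto
  have "u = w'"
  proof (cases "b \<le> length u")
    case True
    moreover from this have "b \<le> length w'"
      using eq(2) Cons.prems(2) windows_eq_Nil_iff by (metis not_less)
    ultimately show ?thesis using Cons eq by blast
  next
    case False
    moreover from this have "\<not> b \<le> length w'"
      using eq(2) Cons.prems(2) windows_eq_Nil_iff by (metis not_less)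
    ultimately show ?thesis using eq(1) by simp
  qed
  with \<open>a = c\<close> w show ?case by simp
qed simp

lemma windows_drop: "windows b (drop n w) = drop n (windows b w)"
proof (induction w arbitrary: n)
  case (Cons a w)
  show ?case
  proof (cases n)
    case (Suc k)
    show ?thesis
    proof (cases "b \<le> Suc (length w)")
      case False
      then show ?thesis using Suc by (simp add: windows_short)
    qed (use Suc Cons in simp)
  qed simp
qed simp

lemma windows_take:
  assumes "0 < b" "n + (b - 1) \<le> length w"
  shows "windows b (take (n + (b - 1)) w) = take n (windows b w)"
  using assms
proof (induction w arbitrary: n)
  case (Cons a w)
  show ?case
  proof (cases n)
    case 0
    then show ?thesis using Cons.prems by (simp add: windows_short)
  next
    case (Suc k)
    have "windows b (take (k + (b - 1)) w) = take k (windows b w)" using Cons Suc by simp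
    moreover have "take b (a # take (k + (b - 1)) w) = take b (a # w)"
      using Cons.prems(1) by (cases b) auto
    moreover have "take (n + (b - 1)) (a # w) = a # take (k + (b - 1)) w" using Suc by simp
    moreover have "b \<le> Suc (length (take (k + (b - 1)) w))" "b \<le> Suc (length w)"
      using Cons.prems Suc by auto
    ultimately show ?thesis using Suc by (simp del: add_diff_assoc)
  qed
qed simp

text \<open>Cutting out a factor of a word and cutting out a factor of its list of windows are the same
  operation, by \<open>windows_drop\<close> and \<open>windows_take\<close>; a factor with \<open>n\<close> windows has length
  \<open>n + (b - 1)\<close>.\<close>

lemma sublist_windows_iff:
  assumes "0 < b" "b \<le> length u"
  shows "sublist (windows b u) (windows b w) \<longleftrightarrow> sublist u w"
proof
  assume "sublist u w"
  then obtain x y where w: "w = x @ u @ y" by (auto simp: sublist_def)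
  let ?n = "length (windows b u)"
  have n: "?n + (b - 1) = length u" using assms by (simp add: length_windows)
  have "windows b u = windows b (take (?n + (b - 1)) (drop (length x) w))"
    unfolding n w by simp
  also have "\<dots> = take ?n (drop (length x) (windows b w))"
    unfolding windows_drop[symmetric] using n w assms by (intro windows_take) auto
  finally show "sublist (windows b u) (windows b w)"
    using sublist_order.order_trans[OF sublist_take sublist_drop] by metis
next
  assume "sublist (windows b u) (windows b w)"
  then obtain x y where w: "windows b w = x @ windows b u @ y" by (auto simp: sublist_def)
  let ?n = "length (windows b u)"
  let ?d = "drop (length x) w"
  have n: "?n + (b - 1) = length u" using assms by (simp add: length_windows)
  have "length (x @ windows b u @ y) = Suc (length w) - b" using w length_windows assms by metis
  then have len: "?n + (b - 1) \<le> length ?d" using n assms by simp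
  have "windows b u = take ?n (windows b ?d)" unfolding windows_drop w by simp
  also have "\<dots> = windows b (take (?n + (b - 1)) ?d)"
    using len assms by (intro windows_take[symmetric]) auto
  finally have eq: "windows b u = windows b (take (?n + (b - 1)) ?d)" .
  have "length (take (?n + (b - 1)) ?d) = length u" using len n by simp
  then have "u = take (?n + (b - 1)) ?d"
    using assms by (intro windows_inj[OF eq]) simp_all
  then show "sublist u w"
    using sublist_order.order_trans[OF sublist_take sublist_drop] by metis
qed

section \<open>The factor graph of a finitely based set\<close>

locale finitely_based =
  fixes A :: "'a set" and C :: "'a list set" and b :: nat
  assumes finite_alphabet: "finite A"
    and closed: "downward_closed A C"
    and infinite: "infinite C"
    and finite_basis: "finite (factor_basis A C)"
    and basis_nonempty: "factor_basis A C \<noteq> {}"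
    and b_eq: "b = max_basis_length A C"
begin

abbreviation \<Gamma> where "\<Gamma> \<equiv> factor_graph A C"

lemma words: "w \<in> C \<Longrightarrow> w \<in> lists A"
  using closed by (auto simp: downward_closed_def)

lemma sublist_closed: "v \<in> C \<Longrightarrow> sublist u v \<Longrightarrow> u \<in> C"
proof -
  assume v: "v \<in> C" "sublist u v"
  then have "u \<in> lists A" using words[of v] set_mono_sublist[of u v] by auto
  with closed v show "u \<in> C" unfolding downward_closed_def by metis
qed

lemma basis_length_le: "m \<in> factor_basis A C \<Longrightarrow> length m \<le> b"
  using finite_basis by (simp add: b_eq max_basis_length_def)

text \<open>Otherwise the empty word would be a basis element and \<open>C\<close> would be empty.\<close>

lemma b_pos: "0 < b"
proof (rule ccontr)
  assume "\<not> 0 < b"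
  obtain m where m: "m \<in> factor_basis A C" using basis_nonempty by blast
  with basis_length_le[OF m] \<open>\<not> 0 < b\<close> have "[] \<notin> C" by (auto simp: factor_basis_def)
  then have "C = {}" using sublist_closed sublist_Nil_left by blast
  with infinite show False by simp
qed

lemma exists_long_word:
  obtains w where "w \<in> C" "b \<le> length w"
proof -
  have "finite {w. set w \<subseteq> A \<and> length w \<le> b}"
    using finite_alphabet by (rule finite_lists_length_le)
  then obtain w where "w \<in> C" "\<not> (set w \<subseteq> A \<and> length w \<le> b)"
    using infinite by (metis (mono_tags, lifting) finite_subset mem_Collect_eq subsetI)
  with words that show thesis by fastforce
qed

text \<open>A word outside \<open>C\<close> contains a basis element, which has length at most \<open>b\<close> and so fits into a window.\<close>

lemma mem_iff_windows:
  assumes "w \<in> lists A" "b \<le> length w"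
  shows "w \<in> C \<longleftrightarrow> set (windows b w) \<subseteq> C"
proof
  assume "w \<in> C"
  then show "set (windows b w) \<subseteq> C" using in_windows sublist_closed by blast
next
  assume sub: "set (windows b w) \<subseteq> C"
  show "w \<in> C"
  proof (rule ccontr)
    assume "w \<notin> C"
    with assms(1) obtain m where m: "m \<in> factor_basis A C" "sublist m w"
      by (rule exists_factor_basis_element)
    then obtain v where "v \<in> set (windows b w)" "sublist m v"
      using factor_in_window[OF m(2) basis_length_le[OF m(1)] assms(2) b_pos] by blast
    with sub have "m \<in> C" by (auto intro: sublist_closed)
    with m(1) show False by (simp add: factor_basis_def)
  qed
qed

lemma pverts_\<Gamma>: "pverts \<Gamma> = {w \<in> C. length w = b}"
  by (simp add: factor_graph_def Let_def b_eq)

lemma parcs_\<Gamma>: "parcs \<Gamma> = {(w, w'). w \<in> pverts \<Gamma> \<and> w' \<in> pverts \<Gamma> \<and>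
    (\<exists>a\<in>A. \<exists>a'\<in>A. \<exists>u\<in>lists A. length u = b - 1 \<and> w = a # u \<and> w' = u @ [a'])}"
  by (simp add: factor_graph_def Let_def b_eq)

lemma vwalk_windows:
  assumes "w \<in> C" "b \<le> length w"
  shows "vwalk (windows b w) (with_proj \<Gamma>)"
proof -
  have "set (vwalk_arcs (windows b w)) \<subseteq> parcs \<Gamma>"
    using assms(1)
  proof (induction w)
    case (Cons a w)
    have w: "w \<in> C" using Cons.prems by (rule sublist_closed) (simp add: sublist_Cons_right)
    show ?case
    proof (cases "b \<le> length w")
      case False
      then show ?thesis by (simp add: windows_short)
    next
      case True
      let ?u = "take (b - 1) w" and ?c = "w ! (b - 1)"
      have verts: "v \<in> pverts \<Gamma>" if "v \<in> set (windows b (a # w))" for v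
        using in_windows[OF that] sublist_closed Cons.prems by (simp add: pverts_\<Gamma>)
      have W: "windows b (a # w) = take b (a # w) # windows b w" using True by simp
      have hd: "windows b w \<noteq> []" "hd (windows b w) = take b w"
        using True b_pos by (simp_all add: windows_eq_Nil_iff hd_windows)
      have "take b (a # w) = a # ?u" using b_pos by (cases b) auto
      moreover have "take b w = ?u @ [?c]"
        using b_pos True by (cases b) (auto simp: take_Suc_conv_app_nth)
      moreover have "a \<in> A" "?c \<in> A" "?u \<in> lists A"
        using words[OF Cons.prems] True b_pos by (auto dest: in_set_takeD simp: in_lists_conv_set)
      moreover have "take b (a # w) \<in> pverts \<Gamma>" "take b w \<in> pverts \<Gamma>"
        using verts hd W by (metis list.set_intros(1), metis list.set_intros(2) list.set_sel(1))
      ultimately have "(take b (a # w), take b w) \<in> parcs \<Gamma>"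
        using True unfolding parcs_\<Gamma> by auto
      then show ?thesis using W hd Cons.IH[OF w] by simp
    qed
  qed simp
  moreover have "set (windows b w) \<subseteq> pverts \<Gamma>"
    using assms in_windows sublist_closed by (fastforce simp: pverts_\<Gamma>)
  moreover have "windows b w \<noteq> []" using assms b_pos by (simp add: windows_eq_Nil_iff)
  ultimately show ?thesis by (intro vwalkI) auto
qed

text \<open>A word is read off a walk from the back, each new vertex adding its first letter. That the word
  belongs to \<open>C\<close> is where the choice of \<open>b\<close> as a bound for the basis matters.\<close>

lemma vwalk_is_windows:
  assumes "vwalk p (with_proj \<Gamma>)"
  obtains w where "w \<in> C" "b \<le> length w" "windows b w = p"
proof -
  have "\<exists>w \<in> lists A. b \<le> length w \<and> windows b w = p"
    using assms
  proof (induction p rule: vwalk_induct)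
    case (Base v)
    then have "v \<in> lists A" "length v = b" using words by (auto simp: pverts_\<Gamma>)
    moreover from this have "windows b v = [v]"
      using b_pos by (cases v) (auto simp: windows_short)
    ultimately show ?case by auto
  next
    case (Cons v v' p)
    then obtain w where w: "w \<in> lists A" "b \<le> length w" "windows b w = v' # p" by blast
    from Cons.hyps(1) obtain a c u where arc: "a \<in> A" "length u = b - 1" "v = a # u" "v' = u @ [c]"
      by (auto simp: parcs_\<Gamma>)
    have "take b w = u @ [c]" using hd_windows[OF b_pos w(2)] w(3) arc by simp
    then have "take (b - 1) w = u"
      using arc(2) by (metis append_eq_conv_conj diff_le_self min.absorb1 take_take)
    then have "take b (a # w) = v" using arc b_pos by (cases b) auto
    then have "windows b (a # w) = v # v' # p" using w by simp
    with w arc(1) show ?case by (intro bexI[of _ "a # w"]) auto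
  qed
  then obtain w where w: "w \<in> lists A" "b \<le> length w" "windows b w = p" by blast
  moreover have "set p \<subseteq> C" using assms by (auto simp: vwalk_def pverts_\<Gamma>)
  ultimately have "w \<in> C" by (simp add: mem_iff_windows)
  with w that show thesis by blast
qed

text \<open>From left to right, condition (ii) comes from embedding a short word jointly with a word of
  length at least \<open>b\<close>. From right to left, condition (ii) replaces short words by words that have
  windows, and hence correspond to walks.\<close>

lemma directed_iff:
  "(\<forall>u\<in>C. \<forall>v\<in>C. \<exists>w\<in>C. sublist u w \<and> sublist v w) \<longleftrightarrow>
    joint_walks \<Gamma> \<and> (\<forall>u\<in>C. length u < b \<longrightarrow> (\<exists>v\<in>C. length v = b \<and> sublist u v))"
    (is "?dir \<longleftrightarrow> ?joint \<and> ?ext")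
proof (intro iffI conjI)
  assume dir: ?dir
  show ?joint
    unfolding joint_walks_def
  proof (intro allI impI)
    fix p q
    assume "vwalk p (with_proj \<Gamma>)" "vwalk q (with_proj \<Gamma>)"
    then obtain u v where uv: "u \<in> C" "b \<le> length u" "windows b u = p"
        "v \<in> C" "b \<le> length v" "windows b v = q"
      by (metis vwalk_is_windows)
    with dir obtain w where w: "w \<in> C" "sublist u w" "sublist v w" by blast
    have "b \<le> length w" using uv(2) sublist_length_le[OF w(2)] by simp
    with w uv show "\<exists>r. vwalk r (with_proj \<Gamma>) \<and> sublist p r \<and> sublist q r"
      using vwalk_windows sublist_windows_iff[OF b_pos] by blast
  qed
  show ?ext
  proof (intro ballI impI)
    fix u assume u: "u \<in> C" "length u < b"
    obtain l where l: "l \<in> C" "b \<le> length l" by (rule exists_long_word)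
    with dir u obtain w where w: "w \<in> C" "sublist u w" "sublist l w" by blast
    have "b \<le> length w" using l(2) sublist_length_le[OF w(3)] by simp
    with u w obtain v where "v \<in> set (windows b w)" "sublist u v"
      using factor_in_window[OF w(2) _ _ b_pos] by auto
    with w(1) show "\<exists>v\<in>C. length v = b \<and> sublist u v"
      using in_windows sublist_closed by blast
  qed
next
  assume "?joint \<and> ?ext"
  then have joint: ?joint and ext: ?ext by blast+
  have long: "\<exists>v\<in>C. b \<le> length v \<and> sublist u v" if "u \<in> C" for u
  proof (cases "length u < b")
    case False
    with that show ?thesis by (intro bexI[of _ u]) auto
  qed (use ext that in fastforce)
  show ?dir
  proof (intro ballI)
    fix u v assume "u \<in> C" "v \<in> C"
    then obtain u' v' where u: "u' \<in> C" "b \<le> length u'" "sublist u u'"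
        and v: "v' \<in> C" "b \<le> length v'" "sublist v v'"
      using long by metis
    from joint obtain r where r: "vwalk r (with_proj \<Gamma>)"
        "sublist (windows b u') r" "sublist (windows b v') r"
      using vwalk_windows[OF u(1,2)] vwalk_windows[OF v(1,2)] unfolding joint_walks_def by blast
    from r(1) obtain w where w: "w \<in> C" "windows b w = r" by (rule vwalk_is_windows)
    have "sublist u' w" "sublist v' w"
      using r(2,3) sublist_windows_iff[OF b_pos u(2), of w] sublist_windows_iff[OF b_pos v(2), of w]
      unfolding w(2) by blast+
    with u(3) v(3) w(1) show "\<exists>w\<in>C. sublist u w \<and> sublist v w"
      by (meson sublist_order.order_trans)
  qed
qed

lemma atomic_iff:
  "atomic_set A C \<longleftrightarrow> (strongly_connected (with_proj \<Gamma>) \<or> bicycle \<Gamma>) \<and>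
    (\<forall>u\<in>C. length u < b \<longrightarrow> (\<exists>v\<in>C. length v = b \<and> sublist u v))"
proof -
  have "pverts \<Gamma> \<subseteq> {w. set w \<subseteq> A \<and> length w = b}"
    using words by (auto simp: pverts_\<Gamma>)
  then have "finite (pverts \<Gamma>)"
    using finite_lists_length_eq[OF finite_alphabet] by (rule finite_subset)
  moreover obtain w where "w \<in> C" "b \<le> length w" by (rule exists_long_word)
  then have "pverts \<Gamma> \<noteq> {}" using vwalk_windows[of w] by (auto simp: vwalk_def)
  moreover have "parcs \<Gamma> \<subseteq> pverts \<Gamma> \<times> pverts \<Gamma>" by (auto simp: parcs_\<Gamma>)
  ultimately show ?thesis
    using joint_walks_iff[of \<Gamma>] directed_iff atomic_set_iff_directed[OF closed] by simp
qed

end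

theorem theorem5p1:
  fixes A :: "'a set" and C :: "'a list set" and b :: nat
  assumes "finite A"
    and "downward_closed A C"
    and "infinite C"
    and "finite (factor_basis A C)"
    and "factor_basis A C \<noteq> {}"
    and "b = max_basis_length A C"
  shows "atomic_set A C \<longleftrightarrow>
    (strongly_connected (with_proj (factor_graph A C)) \<or> bicycle (factor_graph A C)) \<and>
    (\<forall>u\<in>C. length u < b \<longrightarrow> (\<exists>v\<in>C. length v = b \<and> sublist u v))"
proof -
  interpret finitely_based A C b using assms by unfold_locales
  show ?thesis by (rule atomic_iff)
qed

end
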